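(* Let $(k_n)_{n\ge1}$ be a sequence of positive integers and let $(e_n)_{n\ge1}$ be an orthonormal basis of $\mathcal H$. Suppose that for every strictly positive nonincreasing sequence $(d_n)_{n\ge1}$ converging to zero, the operator $D=\operatorname{diag}(d_n)$ (relative to $(e_n)$) is a commutator $D=CZ-ZC$ of bounded operators $C,Z$ where $C$ is compact and at least one of $C$, $Z$ has block tridiagonal form (relative to $(e_n)$) with central block sizes $k_n\times k_n$. Then $(k_n)$ has at least exponential growth: $k_n=\Omega(\rho^n)$ for some $\rho>1$, i.e. there are $\rho>1$ and $c>0$ with $k_n\ge c\rho^n$ for all sufficiently large $n$.
   Context: $\mathcal H$ is an infinite dimensional separable complex Hilbert space. $\operatorname{diag}(d_n)$ is the operator with $De_n=d_ne_n$. Given block sizes $k_n$, put $s_0=0$, $s_n=k_1+\cdots+k_n$, and let $P_n$ be the orthogonal projection onto the span of $e_{s_{n-1}+1},\dots,e_{s_n}$. An operator $S$ is block tridiagonal with central block sizes $k_n\times k_n$ if $P_iSP_j=0$ whenever $|i-j|>1$. *)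

theory Defs
  imports "HOL-Analysis.Analysis" "HOL-Library.Landau_Symbols"
begin

text \<open>
  Complex Hilbert spaces, with inner product linear in the first argument. Positivity and
  definiteness of the inner product are contained in \<open>cinner_same\<close>.
\<close>

class complex_hilbert = banach +
  fixes scaleC :: "complex \<Rightarrow> 'a \<Rightarrow> 'a"  (infixr "*\<^sub>C" 75)
    and cinner :: "'a \<Rightarrow> 'a \<Rightarrow> complex"
  assumes scaleC_add_right: "c *\<^sub>C (x + y) = c *\<^sub>C x + c *\<^sub>C y"
    and scaleC_add_left: "(b + c) *\<^sub>C x = b *\<^sub>C x + c *\<^sub>C x"
    and scaleC_scaleC: "b *\<^sub>C c *\<^sub>C x = (b * c) *\<^sub>C x"
    and scaleR_scaleC: "r *\<^sub>R x = complex_of_real r *\<^sub>C x"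
    and cinner_commute: "cinner x y = cnj (cinner y x)"
    and cinner_add_left: "cinner (x + y) z = cinner x z + cinner y z"
    and cinner_scaleC_left: "cinner (c *\<^sub>C x) y = c * cinner x y"
    and cinner_same: "cinner x x = complex_of_real ((norm x)\<^sup>2)"

global_interpretation complex_vector: vector_space "scaleC :: complex \<Rightarrow> 'a \<Rightarrow> 'a::complex_hilbert"
  defines cspan = complex_vector.span
proof
  fix a b :: complex and x y :: 'a
  show "a *\<^sub>C (x + y) = a *\<^sub>C x + a *\<^sub>C y" by (rule scaleC_add_right)
  show "(a + b) *\<^sub>C x = a *\<^sub>C x + b *\<^sub>C x" by (rule scaleC_add_left)
  show "a *\<^sub>C b *\<^sub>C x = (a * b) *\<^sub>C x" by (rule scaleC_scaleC)
  show "1 *\<^sub>C x = x" using scaleR_scaleC[of 1 x] by simp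
qed

definition bounded_operator :: "('a::complex_hilbert \<Rightarrow> 'a) \<Rightarrow> bool" where
  "bounded_operator T \<longleftrightarrow> bounded_linear T \<and> (\<forall>c x. T (c *\<^sub>C x) = c *\<^sub>C T x)"

definition compact_operator :: "('a::complex_hilbert \<Rightarrow> 'a) \<Rightarrow> bool" where
  "compact_operator T \<longleftrightarrow> bounded_operator T \<and> compact (closure (T ` cball 0 1))"

text \<open>
  Sequences are indexed by the integers \<open>n \<ge> 1\<close>; the value at \<open>0\<close> is never used. A space with an
  orthonormal basis of this kind is infinite dimensional and separable.
\<close>

definition orthonormal_basis :: "(nat \<Rightarrow> 'a::complex_hilbert) \<Rightarrow> bool" where
  "orthonormal_basis e \<longleftrightarrow>
     (\<forall>i\<ge>1. \<forall>j\<ge>1. cinner (e i) (e j) = (if i = j then 1 else 0)) \<and>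
     closure (cspan (e ` {1..})) = UNIV"

text \<open>\<open>D\<close> is the operator \<open>diag(d\<^sub>n)\<close>; for an orthonormal basis there is at most one such \<open>D\<close>.\<close>

definition is_diag :: "(nat \<Rightarrow> 'a::complex_hilbert) \<Rightarrow> (nat \<Rightarrow> real) \<Rightarrow> ('a \<Rightarrow> 'a) \<Rightarrow> bool" where
  "is_diag e d D \<longleftrightarrow> bounded_operator D \<and> (\<forall>n\<ge>1. D (e n) = complex_of_real (d n) *\<^sub>C e n)"

definition orth_proj :: "'a::complex_hilbert set \<Rightarrow> 'a \<Rightarrow> 'a" where
  "orth_proj M x = (THE y. y \<in> M \<and> (\<forall>z\<in>M. cinner (x - y) z = 0))"

definition block_end :: "(nat \<Rightarrow> nat) \<Rightarrow> nat \<Rightarrow> nat" where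
  "block_end k n = (\<Sum>i=1..n. k i)"

definition block_proj :: "(nat \<Rightarrow> nat) \<Rightarrow> (nat \<Rightarrow> 'a::complex_hilbert) \<Rightarrow> nat \<Rightarrow> 'a \<Rightarrow> 'a" where
  "block_proj k e n = orth_proj (cspan (e ` {block_end k (n - 1) + 1..block_end k n}))"

definition block_tridiagonal ::
    "(nat \<Rightarrow> nat) \<Rightarrow> (nat \<Rightarrow> 'a::complex_hilbert) \<Rightarrow> ('a \<Rightarrow> 'a) \<Rightarrow> bool" where
  "block_tridiagonal k e S \<longleftrightarrow>
     (\<forall>i\<ge>1. \<forall>j\<ge>1. \<bar>int i - int j\<bar> > 1 \<longrightarrow>
        (\<forall>x. block_proj k e i (S (block_proj k e j x)) = 0))"

text \<open>
  On the spans used for the blocks, the description in \<open>orth_proj\<close> determines a unique vector,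
  namely the usual finite Fourier sum.
\<close>

lemma cinner_zero_left: "cinner (0::'a::complex_hilbert) y = 0"
  using cinner_add_left[of "0::'a" 0 y] by simp

lemma cinner_diff_left: "cinner (x - y) z = cinner x z - cinner y (z::'a::complex_hilbert)"
  using cinner_add_left[of "x - y" y z] by simp

lemma cinner_sum_left:
  "cinner (sum f A) z = (\<Sum>i\<in>A. cinner (f i) (z::'a::complex_hilbert))"
  by (induction A rule: infinite_finite_induct) (auto simp: cinner_zero_left cinner_add_left)

lemma cinner_eq_0_cspan:
  assumes z: "z \<in> cspan S" and w: "\<And>s. s \<in> S \<Longrightarrow> cinner w s = 0"
  shows "cinner w (z::'a::complex_hilbert) = 0"
proof -
  have "cinner z w = 0"
    using z
  proof (induction rule: complex_vector.span_induct_alt)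
    case base
    show ?case by (rule cinner_zero_left)
  next
    case (step c x y)
    then have "cinner x w = 0" using w[of x] cinner_commute[of x w] by simp
    then show ?case using step by (simp add: cinner_add_left cinner_scaleC_left)
  qed
  then show ?thesis using cinner_commute[of w z] by simp
qed

lemma block_proj_eq_sum:
  assumes "orthonormal_basis e"
  shows "block_proj k e n x =
    (\<Sum>j=block_end k (n - 1) + 1..block_end k n. cinner x (e j) *\<^sub>C e j)"
proof -
  let ?J = "{block_end k (n - 1) + 1..block_end k n}"
  define y where "y = (\<Sum>j\<in>?J. cinner x (e j) *\<^sub>C e j)"
  have y: "y \<in> cspan (e ` ?J)"
    unfolding y_def
    by (intro complex_vector.span_sum complex_vector.span_scale complex_vector.span_base) auto
  have orth: "cinner (x - y) z = 0" if "z \<in> cspan (e ` ?J)" for z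
    using that
  proof (rule cinner_eq_0_cspan)
    fix s assume "s \<in> e ` ?J"
    then obtain i where i: "i \<in> ?J" "s = e i" by auto
    have "cinner y s = (\<Sum>j\<in>?J. cinner x (e j) * cinner (e j) (e i))"
      by (simp add: y_def cinner_sum_left cinner_scaleC_left i)
    also have "\<dots> = (\<Sum>j\<in>?J. if j = i then cinner x (e i) else 0)"
      using assms i by (intro sum.cong) (auto simp: orthonormal_basis_def)
    also have "\<dots> = cinner x s" using i by simp
    finally show "cinner (x - y) s = 0" by (simp add: cinner_diff_left)
  qed
  have "orth_proj (cspan (e ` ?J)) x = y"
    unfolding orth_proj_def
  proof (rule the_equality)
    show "y \<in> cspan (e ` ?J) \<and> (\<forall>z\<in>cspan (e ` ?J). cinner (x - y) z = 0)"
      using y orth by blast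
  next
    fix u assume u: "u \<in> cspan (e ` ?J) \<and> (\<forall>z\<in>cspan (e ` ?J). cinner (x - u) z = 0)"
    have m: "u - y \<in> cspan (e ` ?J)" using u y by (auto intro: complex_vector.span_diff)
    have "cinner (u - y) (u - y) = cinner (x - y) (u - y) - cinner (x - u) (u - y)"
      by (simp add: cinner_diff_left)
    also have "\<dots> = 0" using u m orth by simp
    finally show "u = y" by (simp add: cinner_same)
  qed
  then show ?thesis by (simp add: block_proj_def y_def)
qed

end

theory Submission
  imports Defs
begin

text \<open>
  Write \<open>s\<^sub>n\<close> for \<open>block_end k n\<close>, let \<open>E\<^sub>n\<close> be the projection onto the first \<open>s\<^sub>n\<close> basis vectors and
  \<open>P\<^sub>n\<close> the projection onto block \<open>n\<close>. The theorem comes from playing two estimates of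
  \<open>d\<^sub>1 + \<dots> + d\<^bsub>s(n)\<^esub> = tr (E\<^sub>n D E\<^sub>n)\<close> against each other.

  Upper estimate. The trace of a commutator of finite matrices is zero, so in
  \<open>tr (E\<^sub>n (C Z - Z C) E\<^sub>n)\<close> the terms that stay inside \<open>E\<^sub>n\<close> cancel, and only
  \<open>tr (E\<^sub>n C (1 - E\<^sub>n) Z E\<^sub>n) - tr (E\<^sub>n Z (1 - E\<^sub>n) C E\<^sub>n)\<close> is left. Each of these two traces contains
  one factor \<open>E\<^sub>n S (1 - E\<^sub>n)\<close> or \<open>(1 - E\<^sub>n) S E\<^sub>n\<close> with \<open>S\<close> the block tridiagonal operator, which
  equals \<open>P\<^sub>n S P\<^bsub>n+1\<^esub>\<close> or \<open>P\<^bsub>n+1\<^esub> S P\<^sub>n\<close>. Therefore, whichever of \<open>C\<close> and \<open>Z\<close> is block tridiagonal,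
  the sum \<open>d\<^sub>1 + \<dots> + d\<^bsub>s(n)\<^esub>\<close> equals
  \<open>tr (P\<^sub>n C P\<^bsub>n+1\<^esub> Z P\<^sub>n) - tr (P\<^sub>n Z P\<^bsub>n+1\<^esub> C P\<^sub>n)\<close>.
  These are traces of \<open>k\<^sub>n \<times> k\<^sub>n\<close> matrices whose diagonal entries are at most \<open>\<parallel>P\<^sub>n C\<parallel> \<parallel>Z\<parallel>\<close> and
  \<open>\<parallel>Z\<parallel> \<parallel>P\<^bsub>n+1\<^esub> C\<parallel>\<close>, and \<open>\<parallel>P\<^sub>n C\<parallel> \<rightarrow> 0\<close> because \<open>C\<close> is compact. Hence the sum is below \<open>k\<^sub>n\<close> for all large
  \<open>n\<close> (\<open>partial_sums_of_commutator_diagonal\<close>).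

  Lower estimate. If \<open>k\<^sub>n / s\<^sub>n\<close> were not bounded away from zero, some sequence \<open>d\<close> would decrease
  to zero so slowly that its sum up to \<open>s\<^sub>n\<close> is at least \<open>k\<^sub>n\<close> for infinitely many \<open>n\<close>, which contradicts
  the upper estimate (\<open>block_proportion_bounded_below\<close>). So \<open>k\<^sub>n \<ge> \<delta> s\<^sub>n\<close> for a fixed \<open>\<delta> > 0\<close>: every new block
  multiplies \<open>s\<^sub>n\<close> by at least \<open>1 + \<delta>\<close>, and \<open>k\<^sub>n\<close> inherits this growth.
\<close>

section \<open>Finite Fourier sums\<close>

definition fourier_sum :: "(nat \<Rightarrow> 'a::complex_hilbert) \<Rightarrow> nat set \<Rightarrow> 'a \<Rightarrow> 'a" where
  "fourier_sum e J x = (\<Sum>j\<in>J. cinner x (e j) *\<^sub>C e j)"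

lemma cinner_orthonormal_basis:
  "orthonormal_basis e \<Longrightarrow> i \<ge> 1 \<Longrightarrow> j \<ge> 1 \<Longrightarrow> cinner (e i) (e j) = (if i = j then 1 else 0)"
  by (simp add: orthonormal_basis_def)

lemma scaleC_zero_left: "0 *\<^sub>C x = (0::'a::complex_hilbert)"
  by (rule complex_vector.scale_zero_left)

lemma cinner_add_right: "cinner x (y + z) = cinner x y + cinner x (z::'a::complex_hilbert)"
  using cinner_commute[of x "y + z"] cinner_commute[of x y] cinner_commute[of x z]
  by (simp add: cinner_add_left)

lemma cinner_fourier_sum:
  assumes "orthonormal_basis e" "finite J" "J \<subseteq> {1..}" "i \<ge> 1"
  shows "cinner (fourier_sum e J x) (e i) = (if i \<in> J then cinner x (e i) else 0)"
proof -
  have "cinner (fourier_sum e J x) (e i) = (\<Sum>j\<in>J. cinner x (e j) * cinner (e j) (e i))"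
    by (simp add: fourier_sum_def cinner_sum_left cinner_scaleC_left)
  also have "\<dots> = (\<Sum>j\<in>J. if j = i then cinner x (e i) else 0)"
    using assms by (intro sum.cong) (auto simp: cinner_orthonormal_basis)
  finally show ?thesis using assms by simp
qed

lemma fourier_sum_eq_0:
  "(\<And>j. j \<in> J \<Longrightarrow> cinner x (e j) = 0) \<Longrightarrow> fourier_sum e J x = 0"
  by (simp add: fourier_sum_def scaleC_zero_left)

lemma fourier_sum_add: "fourier_sum e J (x + y) = fourier_sum e J x + fourier_sum e J y"
  by (simp add: fourier_sum_def cinner_add_left scaleC_add_left sum.distrib)

lemma fourier_sum_scaleC: "fourier_sum e J (c *\<^sub>C x) = c *\<^sub>C fourier_sum e J x"
  by (simp add: fourier_sum_def cinner_scaleC_left scaleC_scaleC complex_vector.scale_sum_right)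

lemma fourier_sum_diff: "fourier_sum e J (x - y) = fourier_sum e J x - fourier_sum e J y"
  using fourier_sum_add[of e J "x - y" y] by simp

lemma fourier_sum_basis:
  assumes "orthonormal_basis e" "finite J" "J \<subseteq> {1..}" "i \<in> J"
  shows "fourier_sum e J (e i) = e i"
proof -
  have ge1: "j \<ge> 1" if "j \<in> J" for j using that assms by auto
  have "cinner (e i) (e j) *\<^sub>C e j = (if j = i then e i else 0)" if "j \<in> J" for j
    using cinner_orthonormal_basis[OF assms(1) ge1[OF assms(4)] ge1[OF that]]
    by (simp add: scaleC_zero_left)
  then have "fourier_sum e J (e i) = (\<Sum>j\<in>J. if j = i then e i else 0)"
    unfolding fourier_sum_def by (intro sum.cong) auto
  then show ?thesis using assms by simp
qed

lemma pythagoras_fourier_sum: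
  assumes "orthonormal_basis e" "finite J" "J \<subseteq> {1..}"
  shows "(norm x)\<^sup>2 = (norm (x - fourier_sum e J x))\<^sup>2 + (norm (fourier_sum e J x))\<^sup>2"
proof -
  let ?y = "fourier_sum e J x"
  have "?y \<in> cspan (e ` J)"
    unfolding fourier_sum_def
    by (intro complex_vector.span_sum complex_vector.span_scale complex_vector.span_base) auto
  then have orth: "cinner (x - ?y) ?y = 0"
  proof (rule cinner_eq_0_cspan)
    fix s assume "s \<in> e ` J"
    then obtain i where i: "i \<in> J" "s = e i" by auto
    then have "i \<ge> 1" using assms by auto
    then show "cinner (x - ?y) s = 0" using cinner_fourier_sum[OF assms, of i x] i
      by (simp add: cinner_diff_left)
  qed
  have "cinner x x = cinner ((x - ?y) + ?y) ((x - ?y) + ?y)" by simp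
  also have "\<dots> = cinner (x - ?y) (x - ?y) + cinner ?y ?y"
    using orth cinner_commute[of ?y "x - ?y"]
    by (simp only: cinner_add_left cinner_add_right) simp
  finally show ?thesis
    unfolding cinner_same by (metis of_real_add of_real_eq_iff)
qed

lemma norm_fourier_sum_le:
  assumes "orthonormal_basis e" "finite J" "J \<subseteq> {1..}"
  shows "norm (fourier_sum e J x) \<le> norm x"
  using pythagoras_fourier_sum[OF assms, of x] by (simp add: power2_le_imp_le)

lemma norm_diff_fourier_sum_le:
  assumes "orthonormal_basis e" "finite J" "J \<subseteq> {1..}"
  shows "norm (x - fourier_sum e J x) \<le> norm x"
  using pythagoras_fourier_sum[OF assms, of x] by (simp add: power2_le_imp_le)

lemma norm_basis:
  assumes "orthonormal_basis e" "i \<ge> 1"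
  shows "norm (e i) = 1"
proof -
  have "complex_of_real ((norm (e i))\<^sup>2) = 1"
    using cinner_orthonormal_basis[OF assms assms(2)] by (simp add: cinner_same)
  then have "(norm (e i))\<^sup>2 = 1\<^sup>2" using of_real_eq_1_iff by (metis one_power2)
  then show ?thesis by (rule power2_eq_imp_eq) auto
qed

lemma norm_scaleC: "norm (c *\<^sub>C x) = cmod c * norm (x::'a::complex_hilbert)"
proof -
  have "complex_of_real ((norm (c *\<^sub>C x))\<^sup>2) = c * cinner x (c *\<^sub>C x)"
    by (simp only: cinner_same[symmetric] cinner_scaleC_left)
  also have "cinner x (c *\<^sub>C x) = cnj c * complex_of_real ((norm x)\<^sup>2)"
    using cinner_commute[of x "c *\<^sub>C x"] cinner_commute[of x x]
    by (simp only: cinner_scaleC_left complex_cnj_mult cinner_same[symmetric])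
  also have "c * (cnj c * complex_of_real ((norm x)\<^sup>2)) = c * cnj c * complex_of_real ((norm x)\<^sup>2)"
    by (rule mult.assoc[symmetric])
  also have "\<dots> = complex_of_real ((cmod c * norm x)\<^sup>2)"
    by (simp only: power_mult_distrib of_real_mult complex_norm_square)
  finally have "(norm (c *\<^sub>C x))\<^sup>2 = (cmod c * norm x)\<^sup>2" using of_real_eq_iff by blast
  then show ?thesis by (simp add: power2_eq_iff_nonneg)
qed

lemma norm_cinner_basis_le:
  assumes "orthonormal_basis e" "i \<ge> 1"
  shows "norm (cinner x (e i)) \<le> norm x"
  using norm_fourier_sum_le[OF assms(1), of "{i}" x] assms
  by (simp add: fourier_sum_def norm_scaleC norm_basis)

lemma bounded_linear_cinner_basis:
  assumes "orthonormal_basis e" "i \<ge> 1"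
  shows "bounded_linear (\<lambda>x. cinner x (e i))"
proof (rule bounded_linear_intro[where K = 1])
  show "cinner (r *\<^sub>R x) (e i) = r *\<^sub>R cinner x (e i)" for r x
    by (simp add: scaleR_scaleC cinner_scaleC_left scaleR_conv_of_real)
qed (use norm_cinner_basis_le[OF assms] in \<open>auto simp: cinner_add_left\<close>)

text \<open>
  For a vector in the span of the basis the sums are eventually constant. Since
  \<open>x \<mapsto> x - fourier_sum e {1..m} x\<close> is a contraction, the error at \<open>x\<close> is at most the distance from \<open>x\<close> to such a vector.
\<close>

lemma fourier_sum_tendsto:
  assumes e: "orthonormal_basis e"
  shows "(\<lambda>m. fourier_sum e {1..m} x) \<longlonglongrightarrow> x"
proof (rule metric_LIMSEQ_I)
  fix r :: real assume "r > 0"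
  moreover have "x \<in> closure (cspan (e ` {1..}))"
    using e by (simp add: orthonormal_basis_def)
  ultimately obtain y where y: "y \<in> cspan (e ` {1..})" "dist y x < r"
    by (auto simp: closure_approachable)
  from y(1) have "\<exists>N. \<forall>m\<ge>N. fourier_sum e {1..m} y = y"
  proof (induction rule: complex_vector.span_induct_alt)
    case base
    show ?case by (auto intro!: fourier_sum_eq_0 simp: cinner_zero_left)
  next
    case (step c u v)
    then obtain i N where i: "i \<ge> 1" "u = e i" and "\<forall>m\<ge>N. fourier_sum e {1..m} v = v" by auto
    then have "fourier_sum e {1..m} (c *\<^sub>C u + v) = c *\<^sub>C u + v" if "m \<ge> max i N" for m
      using that fourier_sum_basis[OF e, of "{1..m}" i]
      by (auto simp: fourier_sum_add fourier_sum_scaleC)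
    then show ?case by blast
  qed
  then obtain N where N: "\<And>m. m \<ge> N \<Longrightarrow> fourier_sum e {1..m} y = y" by blast
  have "dist (fourier_sum e {1..m} x) x < r" if "m \<ge> N" for m
  proof -
    have "dist (fourier_sum e {1..m} x) x = norm ((x - y) - fourier_sum e {1..m} (x - y))"
      using N[OF that] by (simp add: fourier_sum_diff dist_norm norm_minus_commute)
    also have "\<dots> \<le> norm (x - y)" by (intro norm_diff_fourier_sum_le[OF e]) auto
    also have "\<dots> < r" using y(2) by (simp add: dist_norm norm_minus_commute)
    finally show ?thesis .
  qed
  then show "\<exists>N. \<forall>m\<ge>N. dist (fourier_sum e {1..m} x) x < r" by blast
qed

lemma eq_0_if_cinner_basis_eq_0:
  assumes "orthonormal_basis e" "\<And>i. i \<ge> 1 \<Longrightarrow> cinner x (e i) = 0"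
  shows "x = 0"
proof -
  have "fourier_sum e {1..m} x = 0" for m using assms(2) by (intro fourier_sum_eq_0) auto
  then show ?thesis using fourier_sum_tendsto[OF assms(1), of x] by (simp add: LIMSEQ_const_iff)
qed

text \<open>
  A substitute for the adjoint: rows of an operator are handled as functionals
  \<open>x \<mapsto> cinner (S x) (e j)\<close>, which are determined by their values on the basis.
\<close>

lemma functional_eq_0_if_basis_eq_0:
  fixes f :: "'a::complex_hilbert \<Rightarrow> complex"
  assumes e: "orthonormal_basis e" and f: "bounded_linear f"
    and lin: "\<And>c x. f (c *\<^sub>C x) = c * f x" and 0: "\<And>i. i \<ge> 1 \<Longrightarrow> f (e i) = 0"
  shows "f x = 0"
proof -
  interpret bounded_linear f by (rule f)
  have "f (fourier_sum e {1..m} x) = 0" for m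
    by (simp add: fourier_sum_def sum lin 0)
  moreover have "(\<lambda>m. f (fourier_sum e {1..m} x)) \<longlonglongrightarrow> f x"
    by (rule tendsto[OF fourier_sum_tendsto[OF e]])
  ultimately show ?thesis by (simp add: LIMSEQ_const_iff)
qed

section \<open>Compact operators\<close>

text \<open>
  On a single vector the Fourier tails tend to zero. A finite \<open>\<epsilon>/2\<close>-net of the image of the unit
  ball makes this uniform, because \<open>fourier_sum e J\<close> is a contraction.
\<close>

lemma compact_operator_tail_small:
  assumes e: "orthonormal_basis e" and C: "compact_operator C" and "\<epsilon> > 0"
  shows "\<exists>m. \<forall>J x. finite J \<longrightarrow> J \<subseteq> {m<..} \<longrightarrow> norm x \<le> 1 \<longrightarrow> norm (fourier_sum e J (C x)) < \<epsilon>"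
proof -
  let ?K = "closure (C ` cball 0 1)"
  have "compact ?K" using C by (simp add: compact_operator_def)
  then have "\<exists>F. finite F \<and> F \<subseteq> ?K \<and> ?K \<subseteq> (\<Union>y\<in>F. ball y (\<epsilon>/2))"
    using seq_compact_imp_totally_bounded[of ?K] \<open>\<epsilon> > 0\<close>
    by (simp add: compact_imp_seq_compact)
  then obtain F where F: "finite F" "?K \<subseteq> (\<Union>y\<in>F. ball y (\<epsilon>/2))" by blast
  have "\<forall>y\<in>F. \<forall>\<^sub>F m in sequentially. dist (fourier_sum e {1..m} y) y < \<epsilon>/2"
    using \<open>\<epsilon> > 0\<close> by (intro ballI tendstoD[OF fourier_sum_tendsto[OF e]]) simp
  then have "\<forall>\<^sub>F m in sequentially. \<forall>y\<in>F. dist (fourier_sum e {1..m} y) y < \<epsilon>/2"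
    using F(1) by (rule eventually_ball_finite[rotated])
  then obtain m where m: "\<And>y. y \<in> F \<Longrightarrow> dist (fourier_sum e {1..m} y) y < \<epsilon>/2"
    using eventually_happens'[OF sequentially_bot] by blast
  have "norm (fourier_sum e J (C x)) < \<epsilon>" if J: "finite J" "J \<subseteq> {m<..}" and x: "norm x \<le> 1" for J x
  proof -
    have J1: "J \<subseteq> {1..}" using J by auto
    have "C x \<in> ?K" using x closure_subset[of "C ` cball 0 1"] by auto
    then obtain y where y: "y \<in> F" "dist y (C x) < \<epsilon>/2" using F by auto
    have "fourier_sum e J (fourier_sum e {1..m} y) = 0"
      using J J1 by (intro fourier_sum_eq_0) (subst cinner_fourier_sum[OF e], auto)
    then have "fourier_sum e J (C x)
        = fourier_sum e J (C x - y) + fourier_sum e J (y - fourier_sum e {1..m} y)"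
      by (simp add: fourier_sum_diff)
    also have "norm \<dots> \<le> norm (C x - y) + norm (y - fourier_sum e {1..m} y)"
      using norm_fourier_sum_le[OF e J(1) J1] norm_triangle_mono by blast
    also have "\<dots> < \<epsilon>" using y m[OF y(1)] by (simp add: dist_norm norm_minus_commute)
    finally show ?thesis .
  qed
  then show ?thesis by blast
qed

section \<open>The truncated trace of a commutator\<close>

text \<open>
  The matrix of \<open>S\<close> is zero in the upper right corner (rows up to \<open>p\<close>, columns beyond \<open>q\<close>) and in the
  transposed corner. A block tridiagonal operator has this form for consecutive block ends \<open>p\<close>, \<open>q\<close>,
  and the trace computation uses the block structure only through this.
\<close>

definition vanishes_beyond :: "(nat \<Rightarrow> 'a::complex_hilbert) \<Rightarrow> ('a \<Rightarrow> 'a) \<Rightarrow> nat \<Rightarrow> nat \<Rightarrow> bool" where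
  "vanishes_beyond e S p q \<longleftrightarrow>
     (\<forall>i\<in>{1..p}. \<forall>j>q. cinner (S (e i)) (e j) = 0 \<and> cinner (S (e j)) (e i) = 0)"

lemma bounded_operatorD:
  assumes "bounded_operator T"
  shows "bounded_linear T" "T (c *\<^sub>C x) = c *\<^sub>C T x"
  using assms by (auto simp: bounded_operator_def)

lemma fourier_sum_split:
  assumes "p \<le> q"
  shows "fourier_sum e {1..q} x = fourier_sum e {1..p} x + fourier_sum e {p<..q} x"
proof -
  have eq: "{1..q} = {1..p} \<union> {p<..q}" using assms by auto
  show ?thesis unfolding fourier_sum_def eq by (rule sum.union_disjoint) auto
qed

lemma tail_of_column:
  assumes e: "orthonormal_basis e" and pq: "p \<le> q"
    and S: "vanishes_beyond e S p q" and j: "j \<in> {1..p}"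
  shows "S (e j) - fourier_sum e {1..p} (S (e j)) = fourier_sum e {p<..q} (S (e j))"
proof -
  have "S (e j) - fourier_sum e {1..q} (S (e j)) = 0"
  proof (rule eq_0_if_cinner_basis_eq_0[OF e])
    fix i :: nat assume "i \<ge> 1"
    then show "cinner (S (e j) - fourier_sum e {1..q} (S (e j))) (e i) = 0"
      using S j cinner_fourier_sum[OF e, of "{1..q}" i]
      by (auto simp: cinner_diff_left vanishes_beyond_def)
  qed
  then show ?thesis using fourier_sum_split[OF pq, of e "S (e j)"] by (simp add: algebra_simps)
qed

text \<open>
  The counterpart for rows of the preceding statement about columns. After splitting off the entries
  in \<open>{p<..q}\<close>, what remains is the functional \<open>x \<mapsto> cinner (S (x - fourier_sum e {1..q} x)) (e j)\<close>. It
  vanishes on \<open>e i\<close> for \<open>i \<le> q\<close> since the argument of \<open>S\<close> does, and for \<open>i > q\<close> by the shape of \<open>S\<close>.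
\<close>

lemma row_applied_to_tail:
  assumes e: "orthonormal_basis e" and bS: "bounded_operator S" and pq: "p \<le> q"
    and S: "vanishes_beyond e S p q" and j: "j \<in> {1..p}"
  shows "cinner (S (x - fourier_sum e {1..p} x)) (e j) = cinner (S (fourier_sum e {p<..q} x)) (e j)"
proof -
  interpret S: bounded_linear S by (rule bounded_operatorD[OF bS])
  have F: "bounded_linear (fourier_sum e {1..q})"
  proof (rule bounded_linear_intro[where K = 1])
    show "fourier_sum e {1..q} (r *\<^sub>R x) = r *\<^sub>R fourier_sum e {1..q} x" for r x
      by (simp add: scaleR_scaleC fourier_sum_scaleC)
  qed (use norm_fourier_sum_le[OF e] in \<open>auto simp: fourier_sum_add\<close>)
  let ?f = "\<lambda>x. cinner (S (x - fourier_sum e {1..q} x)) (e j)"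
  have "?f x = 0"
  proof (rule functional_eq_0_if_basis_eq_0[OF e, where f = ?f])
    have "bounded_linear (\<lambda>x. S (x - fourier_sum e {1..q} x))"
      by (intro bounded_linear_compose[OF S.bounded_linear_axioms] bounded_linear_sub
          bounded_linear_ident F)
    then show "bounded_linear ?f"
      using bounded_linear_compose[OF bounded_linear_cinner_basis[OF e]] j by auto
  next
    show "?f (c *\<^sub>C x) = c * ?f x" for c x
      by (simp add: fourier_sum_scaleC complex_vector.scale_right_diff_distrib[symmetric]
          bounded_operatorD[OF bS] cinner_scaleC_left)
  next
    fix i :: nat assume i: "i \<ge> 1"
    show "?f (e i) = 0"
    proof (cases "i \<le> q")
      case True
      then show ?thesis using i fourier_sum_basis[OF e, of "{1..q}" i]
        by (simp add: S.zero cinner_zero_left)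
    next
      case False
      then have "fourier_sum e {1..q} (e i) = 0"
        using i cinner_orthonormal_basis[OF e i] by (intro fourier_sum_eq_0) auto
      then show ?thesis using False S j by (auto simp: vanishes_beyond_def)
    qed
  qed
  moreover have "x - fourier_sum e {1..p} x
      = (x - fourier_sum e {1..q} x) + fourier_sum e {p<..q} x"
    using fourier_sum_split[OF pq, of e x] by simp
  ultimately show ?thesis by (simp only: S.add cinner_add_left add_0_left)
qed

lemma column_corner_eq_0:
  assumes "vanishes_beyond e S l p" "j \<in> {1..l}"
  shows "fourier_sum e {p<..q} (S (e j)) = 0"
  using assms by (intro fourier_sum_eq_0) (auto simp: vanishes_beyond_def)

lemma row_corner_eq_0:
  assumes "bounded_operator S" "vanishes_beyond e S l p" "j \<in> {1..l}"
  shows "cinner (S (fourier_sum e {p<..q} x)) (e j) = 0"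
proof -
  interpret S: bounded_linear S by (rule bounded_operatorD[OF assms(1)])
  show ?thesis using assms(2,3)
    by (simp add: fourier_sum_def S.sum bounded_operatorD(2)[OF assms(1)] cinner_sum_left
        cinner_scaleC_left vanishes_beyond_def)
qed

text \<open>
  For the truncations \<open>C'\<close>, \<open>Z'\<close> of \<open>C\<close>, \<open>Z\<close> to the span of \<open>e ` J\<close> the traces of \<open>C' Z'\<close> and \<open>Z' C'\<close> are
  the same finite double sum in two orders. Only what leaves the span after the first factor
  contributes.
\<close>

lemma truncated_trace_commutator:
  assumes C: "bounded_operator C" and Z: "bounded_operator Z"
  shows "(\<Sum>j\<in>J. cinner (C (Z (e j)) - Z (C (e j))) (e j)) =
    (\<Sum>j\<in>J. cinner (C (Z (e j) - fourier_sum e J (Z (e j)))) (e j)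
            - cinner (Z (C (e j) - fourier_sum e J (C (e j)))) (e j))"
proof -
  interpret C: bounded_linear C by (rule bounded_operatorD[OF C])
  interpret Z: bounded_linear Z by (rule bounded_operatorD[OF Z])
  have "(\<Sum>j\<in>J. cinner (C (fourier_sum e J (Z (e j)))) (e j))
      = (\<Sum>j\<in>J. \<Sum>i\<in>J. cinner (Z (e j)) (e i) * cinner (C (e i)) (e j))"
    by (simp add: fourier_sum_def C.sum bounded_operatorD(2)[OF C] cinner_sum_left
        cinner_scaleC_left)
  also have "\<dots> = (\<Sum>j\<in>J. \<Sum>i\<in>J. cinner (C (e j)) (e i) * cinner (Z (e i)) (e j))"
    by (subst sum.swap) (simp add: mult.commute)
  also have "\<dots> = (\<Sum>j\<in>J. cinner (Z (fourier_sum e J (C (e j)))) (e j))"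
    by (simp add: fourier_sum_def Z.sum bounded_operatorD(2)[OF Z] cinner_sum_left
        cinner_scaleC_left)
  finally show ?thesis
    by (simp add: C.diff Z.diff cinner_diff_left sum_subtractf)
qed

text \<open>
  Here \<open>l\<close>, \<open>p\<close>, \<open>q\<close> are three consecutive block ends. The shape beyond \<open>q\<close> cuts the tail after \<open>p\<close> down to
  \<open>{p<..q}\<close>, and the shape for \<open>l\<close>, \<open>p\<close> removes all indices \<open>j \<le> l\<close>, so that the number of remaining
  terms is the size of one block. Each of the two traces contains one factor \<open>C\<close> and one factor \<open>Z\<close>, one used
  as a row and the other as a column, which is why it suffices that either of them has this shape.
\<close>

lemma truncated_trace_localised:
  assumes e: "orthonormal_basis e" and C: "bounded_operator C" and Z: "bounded_operator Z"
    and lpq: "l \<le> p" "p \<le> q"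
    and van: "vanishes_beyond e C l p \<and> vanishes_beyond e C p q
            \<or> vanishes_beyond e Z l p \<and> vanishes_beyond e Z p q"
  shows "(\<Sum>j\<in>{1..p}. cinner (C (Z (e j)) - Z (C (e j))) (e j)) =
    (\<Sum>j\<in>{l<..p}. cinner (C (fourier_sum e {p<..q} (Z (e j)))) (e j)
                - cinner (Z (fourier_sum e {p<..q} (C (e j)))) (e j))"
proof -
  let ?t = "\<lambda>j. cinner (C (fourier_sum e {p<..q} (Z (e j)))) (e j)
               - cinner (Z (fourier_sum e {p<..q} (C (e j)))) (e j)"
  have C0: "C 0 = 0" and Z0: "Z 0 = 0"
    using C Z by (auto dest!: bounded_operatorD(1) simp: linear_0 bounded_linear.linear)
  have trace: "cinner (C (Z (e j) - fourier_sum e {1..p} (Z (e j)))) (e j)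
      - cinner (Z (C (e j) - fourier_sum e {1..p} (C (e j)))) (e j) = ?t j" if "j \<in> {1..p}" for j
    using van
  proof
    assume "vanishes_beyond e C l p \<and> vanishes_beyond e C p q"
    then have "vanishes_beyond e C p q" ..
    then show ?thesis
      by (simp only: row_applied_to_tail[OF e C lpq(2) _ that] tail_of_column[OF e lpq(2) _ that])
  next
    assume "vanishes_beyond e Z l p \<and> vanishes_beyond e Z p q"
    then have "vanishes_beyond e Z p q" ..
    then show ?thesis
      by (simp only: row_applied_to_tail[OF e Z lpq(2) _ that] tail_of_column[OF e lpq(2) _ that])
  qed
  have corner: "?t j = 0" if "j \<in> {1..l}" for j
    using van
  proof
    assume "vanishes_beyond e C l p \<and> vanishes_beyond e C p q"
    then have "vanishes_beyond e C l p" ..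
    then show ?thesis
      by (simp only: row_corner_eq_0[OF C _ that] column_corner_eq_0[OF _ that] Z0
          cinner_zero_left diff_self)
  next
    assume "vanishes_beyond e Z l p \<and> vanishes_beyond e Z p q"
    then have "vanishes_beyond e Z l p" ..
    then show ?thesis
      by (simp only: row_corner_eq_0[OF Z _ that] column_corner_eq_0[OF _ that] C0
          cinner_zero_left diff_self)
  qed
  have "(\<Sum>j\<in>{1..p}. cinner (C (Z (e j)) - Z (C (e j))) (e j)) = (\<Sum>j\<in>{1..p}. ?t j)"
    unfolding truncated_trace_commutator[OF C Z] by (rule sum.cong[OF refl trace])
  also have "\<dots> = (\<Sum>j\<in>{l<..p}. ?t j)"
    using lpq corner by (intro sum.mono_neutral_right) auto
  finally show ?thesis .
qed

section \<open>Block tridiagonal operators\<close>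

lemma block_end_Suc: "block_end k (Suc n) = block_end k n + k (Suc n)"
  by (simp add: block_end_def)

lemma block_end_0 [simp]: "block_end k 0 = 0"
  by (simp add: block_end_def)

lemma block_end_mono: "m \<le> n \<Longrightarrow> block_end k m \<le> block_end k n"
  unfolding block_end_def by (intro sum_mono2) auto

lemma le_block_end:
  assumes "\<forall>n\<ge>1. k n > 0"
  shows "n \<le> block_end k n"
proof (induction n)
  case (Suc n)
  moreover have "k (Suc n) > 0" using assms by simp
  ultimately show ?case by (simp add: block_end_Suc)
qed simp

lemma block_exists:
  assumes k: "\<forall>n\<ge>1. k n > 0" and i: "i \<ge> 1"
  obtains b where "b \<ge> 1" "block_end k (b - 1) < i" "i \<le> block_end k b"
proof -
  define b where "b = (LEAST b. i \<le> block_end k b)"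
  have b: "i \<le> block_end k b"
    unfolding b_def by (rule LeastI) (rule le_block_end[OF k])
  then have "b \<noteq> 0" using i by (intro notI) simp
  then have "\<not> i \<le> block_end k (b - 1)" unfolding b_def by (intro not_less_Least) (simp add: b_def)
  then show ?thesis using that[of b] b \<open>b \<noteq> 0\<close> by (simp add: not_le)
qed

lemma block_tridiagonal_entry_eq_0:
  assumes e: "orthonormal_basis e" and S: "block_tridiagonal k e S"
    and a: "a \<ge> 1" "block_end k (a - 1) < i" "i \<le> block_end k a"
    and b: "b \<ge> 1" "block_end k (b - 1) < j" "j \<le> block_end k b"
    and ab: "\<bar>int b - int a\<bar> > 1"
  shows "cinner (S (e i)) (e j) = 0"
proof -
  have proj: "block_proj k e n = fourier_sum e {block_end k (n - 1) + 1..block_end k n}" for n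
    by (rule ext) (simp add: block_proj_eq_sum[OF e] fourier_sum_def)
  have "block_proj k e a (e i) = e i"
    unfolding proj using a by (intro fourier_sum_basis[OF e]) auto
  then have "block_proj k e b (S (e i)) = 0"
    using S a(1) b(1) ab by (metis block_tridiagonal_def)
  then show ?thesis
    using b cinner_fourier_sum[OF e, of "{block_end k (b - 1) + 1..block_end k b}" j "S (e i)"]
    by (auto simp: proj cinner_zero_left)
qed

lemma block_tridiagonal_vanishes_beyond:
  assumes e: "orthonormal_basis e" and k: "\<forall>n\<ge>1. k n > 0" and S: "block_tridiagonal k e S"
  shows "vanishes_beyond e S (block_end k n) (block_end k (Suc n))"
  unfolding vanishes_beyond_def
proof (intro ballI allI impI)
  fix i j assume i: "i \<in> {1..block_end k n}" and j: "block_end k (Suc n) < j"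
  obtain a where a: "a \<ge> 1" "block_end k (a - 1) < i" "i \<le> block_end k a"
    using block_exists[OF k, of i] i by auto
  obtain b where b: "b \<ge> 1" "block_end k (b - 1) < j" "j \<le> block_end k b"
    using block_exists[OF k, of j] j by auto
  have "a - 1 < n" using a(2) i block_end_mono[of n "a - 1" k] by (cases "a - 1 < n") auto
  moreover have "Suc n < b" using b(3) j block_end_mono[of b "Suc n" k] by (cases "Suc n < b") auto
  ultimately have "\<bar>int b - int a\<bar> > 1" "\<bar>int a - int b\<bar> > 1" by auto
  then show "cinner (S (e i)) (e j) = 0 \<and> cinner (S (e j)) (e i) = 0"
    using block_tridiagonal_entry_eq_0[OF e S a b] block_tridiagonal_entry_eq_0[OF e S b a] by blast
qed

text \<open>
  The localised trace has \<open>k n\<close> terms, and each of them becomes small by compactness of \<open>C\<close>. In the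
  first part of a term, \<open>C\<close> is applied last and its row \<open>j\<close> is small as a functional; in the second part
  \<open>C\<close> is applied first and then projected to a late block. Both parts are
  controlled by the Fourier tails of \<open>C x\<close>, uniformly for \<open>norm x \<le> 1\<close>.
\<close>

lemma partial_sums_of_commutator_diagonal:
  assumes e: "orthonormal_basis e" and k: "\<forall>n\<ge>1. k n > 0"
    and D: "is_diag e d D" and C: "compact_operator C" and Z: "bounded_operator Z"
    and comm: "\<forall>x. D x = C (Z x) - Z (C x)"
    and tri: "block_tridiagonal k e C \<or> block_tridiagonal k e Z"
  shows "\<forall>\<^sub>F n in sequentially. (\<Sum>j\<in>{1..block_end k n}. d j) < real (k n)"
proof -
  have bC: "bounded_operator C" using C by (simp add: compact_operator_def)
  interpret Z: bounded_linear Z by (rule bounded_operatorD[OF Z])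
  interpret C: bounded_linear C by (rule bounded_operatorD[OF bC])
  obtain B where B: "B > 0" "\<And>x. norm (Z x) \<le> norm x * B" using Z.pos_bounded by blast
  \<comment> \<open>Each term of the localised trace is below \<open>2 * \<epsilon> * B\<close>, which is to be \<open>1\<close>.\<close>
  define \<epsilon> where "\<epsilon> = 1 / (2 * B)"
  have "\<epsilon> > 0" using B by (simp add: \<epsilon>_def)
  then obtain m where m: "\<And>J x. finite J \<Longrightarrow> J \<subseteq> {m<..} \<Longrightarrow> norm x \<le> 1 \<Longrightarrow>
      norm (fourier_sum e J (C x)) < \<epsilon>"
    using compact_operator_tail_small[OF e C] by blast
  have row: "norm (cinner (C w) (e j)) \<le> \<epsilon> * norm w" if "j > m" for j w
  proof (cases "w = 0")
    case False
    let ?u = "w /\<^sub>R norm w"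
    have "norm (cinner (C ?u) (e j)) = norm (fourier_sum e {j} (C ?u))"
      using norm_basis[OF e, of j] that by (simp add: fourier_sum_def norm_scaleC)
    also have "\<dots> \<le> \<epsilon>" using m[of "{j}" ?u] that False by (auto intro: less_imp_le)
    finally have u: "norm (cinner (C ?u) (e j)) \<le> \<epsilon>" .
    have "w = complex_of_real (norm w) *\<^sub>C ?u"
      using False by (simp add: scaleR_scaleC[symmetric])
    then have "cinner (C w) (e j) = complex_of_real (norm w) * cinner (C ?u) (e j)"
      by (metis bounded_operatorD(2)[OF bC] cinner_scaleC_left)
    then have "norm (cinner (C w) (e j)) = norm (cinner (C ?u) (e j)) * norm w"
      by (simp only: norm_mult norm_of_real abs_norm_cancel mult.commute)
    then show ?thesis using mult_right_mono[OF u norm_ge_zero[of w]] by simp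
  qed (simp add: C.zero cinner_zero_left)
  have "(\<Sum>j\<in>{1..block_end k n}. d j) < real (k n)" if n: "n \<ge> Suc m" for n
  proof -
    \<comment> \<open>With \<open>m \<le> n'\<close> also \<open>m \<le> block_end k n'\<close>, so block \<open>n\<close> lies in the range where \<open>m\<close> gives smallness.\<close>
    obtain n' where n': "n = Suc n'" "n' \<ge> m" using n by (cases n) auto
    let ?l = "block_end k n'" and ?p = "block_end k n" and ?q = "block_end k (Suc n)"
    let ?J = "{?p<..?q}"
    have lpq: "?l \<le> ?p" "?p \<le> ?q" by (auto intro!: block_end_mono simp: n')
    have ml: "m \<le> ?l" using n' le_block_end[OF k, of n'] by simp
    have J: "finite ?J" "?J \<subseteq> {m<..}" "?J \<subseteq> {1..}" using ml lpq by auto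
    have van: "vanishes_beyond e C ?l ?p \<and> vanishes_beyond e C ?p ?q
            \<or> vanishes_beyond e Z ?l ?p \<and> vanishes_beyond e Z ?p ?q"
      using tri block_tridiagonal_vanishes_beyond[OF e k] unfolding n'(1) by blast
    let ?t = "\<lambda>j. cinner (C (fourier_sum e ?J (Z (e j)))) (e j)
                 - cinner (Z (fourier_sum e ?J (C (e j)))) (e j)"
    have t: "norm (?t j) < 1" if j: "j \<in> {?l<..?p}" for j
    proof -
      have j1: "j \<ge> 1" "j > m" using j ml by auto
      have ej: "norm (e j) = 1" by (rule norm_basis[OF e j1(1)])
      have "norm (cinner (C (fourier_sum e ?J (Z (e j)))) (e j))
          \<le> \<epsilon> * norm (fourier_sum e ?J (Z (e j)))" by (rule row[OF j1(2)])
      also have "\<dots> \<le> \<epsilon> * B"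
        using norm_fourier_sum_le[OF e J(1,3), of "Z (e j)"] B(2)[of "e j"] ej \<open>\<epsilon> > 0\<close>
        by (intro mult_left_mono) auto
      finally have 1: "norm (cinner (C (fourier_sum e ?J (Z (e j)))) (e j)) \<le> \<epsilon> * B" .
      have "norm (cinner (Z (fourier_sum e ?J (C (e j)))) (e j))
          \<le> norm (Z (fourier_sum e ?J (C (e j))))" by (rule norm_cinner_basis_le[OF e j1(1)])
      also have "\<dots> \<le> norm (fourier_sum e ?J (C (e j))) * B" by (rule B(2))
      also have "\<dots> < \<epsilon> * B" using m[OF J(1,2), of "e j"] ej B(1) by simp
      finally have 2: "norm (cinner (Z (fourier_sum e ?J (C (e j)))) (e j)) < \<epsilon> * B" .
      have "\<epsilon> * B = 1 / 2" using B(1) by (simp add: \<epsilon>_def)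
      then show ?thesis using 1 2 norm_triangle_ineq4[of "cinner (C (fourier_sum e ?J (Z (e j)))) (e j)"
          "cinner (Z (fourier_sum e ?J (C (e j)))) (e j)"] by linarith
    qed
    have diag: "cinner (C (Z (e j)) - Z (C (e j))) (e j) = complex_of_real (d j)" if "j \<in> {1..?p}" for j
    proof -
      have "D (e j) = complex_of_real (d j) *\<^sub>C e j" using D that by (simp add: is_diag_def)
      then show ?thesis using that cinner_orthonormal_basis[OF e, of j j]
        by (simp add: comm[rule_format, symmetric] cinner_scaleC_left)
    qed
    have card: "card {?l<..?p} = k n" by (simp add: n' block_end_Suc)
    have "complex_of_real (\<Sum>j\<in>{1..?p}. d j)
        = (\<Sum>j\<in>{1..?p}. cinner (C (Z (e j)) - Z (C (e j))) (e j))"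
      by (simp only: of_real_sum) (rule sum.cong[OF refl], simp only: diag)
    also have "\<dots> = (\<Sum>j\<in>{?l<..?p}. ?t j)"
      by (rule truncated_trace_localised[OF e bC Z lpq van])
    finally have eq: "complex_of_real (\<Sum>j\<in>{1..?p}. d j) = (\<Sum>j\<in>{?l<..?p}. ?t j)" .
    have "(\<Sum>j\<in>{1..?p}. d j) \<le> norm (complex_of_real (\<Sum>j\<in>{1..?p}. d j))"
      by (simp only: norm_of_real abs_ge_self)
    also have "\<dots> = norm (\<Sum>j\<in>{?l<..?p}. ?t j)" by (simp only: eq)
    also have "\<dots> \<le> (\<Sum>j\<in>{?l<..?p}. norm (?t j))" by (rule norm_sum)
    also have "\<dots> < (\<Sum>j\<in>{?l<..?p}. 1)"
    proof (rule sum_strict_mono)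
      have "k n > 0" using k n by auto
      then show "{?l<..?p} \<noteq> {}" using card by (metis card.empty less_irrefl)
    qed (use t in auto)
    also have "\<dots> = real (k n)" using card by simp
    finally show ?thesis .
  qed
  then show ?thesis by (auto simp: eventually_sequentially)
qed

section \<open>Growth of the block sizes\<close>

text \<open>
  The first index at which \<open>r\<close> drops below all of its values up to \<open>N\<close> is a record beyond \<open>N\<close>.
\<close>

lemma infinitely_many_strict_records:
  fixes r :: "nat \<Rightarrow> real"
  assumes pos: "\<And>n. n \<ge> 1 \<Longrightarrow> r n > 0" and small: "\<And>\<delta>. \<delta> > 0 \<Longrightarrow> \<exists>n\<ge>1. r n < \<delta>"
  shows "\<exists>n\<ge>N. n \<ge> 1 \<and> r n < 1 \<and> (\<forall>i\<in>{1..<n}. r n < r i)"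
proof -
  define \<delta> where "\<delta> = Min (insert 1 (r ` {1..N}))"
  have "\<delta> > 0" unfolding \<delta>_def using pos by auto
  then have ex: "\<exists>n. n \<ge> 1 \<and> r n < \<delta>" using small by blast
  define n where "n = (LEAST n. n \<ge> 1 \<and> r n < \<delta>)"
  have n: "n \<ge> 1" "r n < \<delta>" unfolding n_def using LeastI_ex[OF ex] by auto
  have le: "\<delta> \<le> 1" "\<And>i. i \<in> {1..N} \<Longrightarrow> \<delta> \<le> r i"
    unfolding \<delta>_def by (rule Min_le; simp)+
  have "n > N"
  proof (rule ccontr)
    assume "\<not> n > N" then show False using le(2)[of n] n by auto
  qed
  moreover have "r n < r i" if "i \<in> {1..<n}" for i
    using not_less_Least[of i "\<lambda>n. n \<ge> 1 \<and> r n < \<delta>"] that n(2) unfolding n_def[symmetric] by auto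
  ultimately show ?thesis using n le(1) by (intro exI[of _ n]) auto
qed

text \<open>
  Suppose that \<open>r n = k n / block_end k n\<close> comes arbitrarily close to zero. Let \<open>d m\<close> be the running
  minimum of \<open>r\<close> over the blocks that end before \<open>m\<close>, capped by \<open>1\<close>. It decreases to zero, and it reacts to
  the value \<open>r n\<close> only after block \<open>n\<close> is over: if \<open>r n\<close> is a new strict minimum, then \<open>d\<close> is still
  at least \<open>r n\<close> on all of \<open>{1..block_end k n}\<close>, so its sum there is at least \<open>k n\<close>.
\<close>

lemma block_proportion_bounded_below:
  assumes k: "\<forall>n\<ge>1. k n > 0"
    and small_sums: "\<And>d :: nat \<Rightarrow> real. \<lbrakk>\<And>n. n \<ge> 1 \<Longrightarrow> d n > 0; \<And>n. n \<ge> 1 \<Longrightarrow> d (n + 1) \<le> d n; d \<longlonglongrightarrow> 0\<rbrakk>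
      \<Longrightarrow> \<forall>\<^sub>F n in sequentially. (\<Sum>j\<in>{1..block_end k n}. d j) < real (k n)"
  shows "\<exists>\<delta>>0. \<forall>n\<ge>1. \<delta> * real (block_end k n) \<le> real (k n)"
proof (rule ccontr)
  assume contra: "\<not> ?thesis"
  define r where "r = (\<lambda>n. real (k n) / real (block_end k n))"
  have s_pos: "block_end k n > 0" if "n \<ge> 1" for n using le_block_end[OF k, of n] that by simp
  have r_pos: "r n > 0" if "n \<ge> 1" for n using k s_pos that by (simp add: r_def)
  have r_small: "\<exists>n\<ge>1. r n < \<delta>" if "\<delta> > 0" for \<delta>
  proof -
    obtain n where "n \<ge> 1" "real (k n) < \<delta> * real (block_end k n)"
      using contra \<open>\<delta> > 0\<close> by (auto simp: not_le)
    then show ?thesis using s_pos[of n] by (intro exI[of _ n]) (simp add: r_def field_simps)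
  qed
  define I where "I = (\<lambda>m. {i. i \<ge> 1 \<and> block_end k i < m})"
  have fin: "finite (I m)" for m
  proof (rule finite_subset)
    show "I m \<subseteq> {..<m}"
      using order.strict_trans1[OF le_block_end[OF k]] by (auto simp: I_def)
  qed simp
  define d where "d = (\<lambda>m. Min (insert 1 (r ` I m)))"
  have d_pos: "d m > 0" for m
    unfolding d_def using fin r_pos by (subst Min_gr_iff) (auto simp: I_def)
  have d_mono: "d m' \<le> d m" if "m \<le> m'" for m m'
    unfolding d_def using fin that by (intro Min_antimono) (auto simp: I_def)
  have "d \<longlonglongrightarrow> 0"
  proof (rule metric_LIMSEQ_I)
    fix \<delta> :: real assume "\<delta> > 0"
    then obtain i where i: "i \<ge> 1" "r i < \<delta>" using r_small by blast
    have "dist (d m) 0 < \<delta>" if "m \<ge> Suc (block_end k i)" for m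
    proof -
      have "d m \<le> r i" unfolding d_def using fin i that by (intro Min_le) (auto simp: I_def)
      then show ?thesis using i d_pos[of m] by simp
    qed
    then show "\<exists>N. \<forall>m\<ge>N. dist (d m) 0 < \<delta>" by blast
  qed
  then have "\<forall>\<^sub>F n in sequentially. (\<Sum>j\<in>{1..block_end k n}. d j) < real (k n)"
    using d_pos d_mono by (intro small_sums) auto
  then obtain N where N: "\<And>n. n \<ge> N \<Longrightarrow> (\<Sum>j\<in>{1..block_end k n}. d j) < real (k n)"
    by (auto simp: eventually_sequentially)
  obtain n where n: "n \<ge> N" "n \<ge> 1" "r n < 1" "\<And>i. i \<in> {1..<n} \<Longrightarrow> r n < r i"
    using infinitely_many_strict_records[OF r_pos r_small] by blast
  have I_sub: "I (block_end k n) \<subseteq> {1..<n}"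
  proof
    fix i assume "i \<in> I (block_end k n)"
    then have i: "i \<ge> 1" "block_end k i < block_end k n" by (auto simp: I_def)
    then show "i \<in> {1..<n}" using block_end_mono[of n i k] by (cases "i < n") auto
  qed
  have "r n \<le> d (block_end k n)"
    unfolding d_def using fin n(3,4) I_sub by (subst Min_ge_iff) (auto intro!: less_imp_le)
  then have "real (k n) \<le> (\<Sum>j\<in>{1..block_end k n}. d (block_end k n))"
    using s_pos[OF n(2)] by (simp add: r_def field_simps)
  also have "\<dots> \<le> (\<Sum>j\<in>{1..block_end k n}. d j)"
    by (intro sum_mono d_mono) auto
  finally show False using N[OF n(1)] by simp
qed

lemma exponential_growth_if_proportion_bounded_below:
  assumes k: "\<forall>n\<ge>1. k n > 0" and "\<delta> > 0"
    and share: "\<forall>n\<ge>1. \<delta> * real (block_end k n) \<le> real (k n)"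
  shows "\<exists>\<rho>>1. (\<lambda>n. real (k n)) \<in> \<Omega>(\<lambda>n. \<rho> ^ n)"
proof (intro exI[of _ "1 + \<delta>"] conjI)
  have growth: "(1 + \<delta>) ^ n \<le> real (block_end k (Suc n))" for n
  proof (induction n)
    case 0
    then show ?case using le_block_end[OF k, of 1] by simp
  next
    case (Suc n)
    let ?s = "real (block_end k (Suc n))"
    have "?s \<le> real (block_end k (Suc (Suc n)))" using block_end_mono[of "Suc n" "Suc (Suc n)" k] by simp
    then have "\<delta> * ?s \<le> \<delta> * real (block_end k (Suc (Suc n)))"
      using \<open>\<delta> > 0\<close> by simp
    also have "\<dots> \<le> real (k (Suc (Suc n)))" using share by simp
    finally have "\<delta> * ?s \<le> real (k (Suc (Suc n)))" .
    then have "(1 + \<delta>) * ?s \<le> real (block_end k (Suc (Suc n)))"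
      by (simp add: block_end_Suc[of k "Suc n"] algebra_simps)
    moreover have "(1 + \<delta>) ^ Suc n \<le> (1 + \<delta>) * ?s"
      using Suc \<open>\<delta> > 0\<close> by (simp add: mult_left_mono)
    ultimately show ?case by linarith
  qed
  show "(\<lambda>n. real (k n)) \<in> \<Omega>(\<lambda>n. (1 + \<delta>) ^ n)"
  proof (rule landau_omega.bigI[of "\<delta> / (1 + \<delta>)"])
    show "\<forall>\<^sub>F n in sequentially. norm (real (k n)) \<ge> \<delta> / (1 + \<delta>) * norm ((1 + \<delta>) ^ n)"
    proof (rule eventually_sequentiallyI[of 1])
      fix n :: nat assume n: "n \<ge> 1"
      then obtain m where m: "n = Suc m" by (cases n) auto
      have "\<delta> / (1 + \<delta>) * (1 + \<delta>) ^ n = \<delta> * (1 + \<delta>) ^ m"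
        using \<open>\<delta> > 0\<close> by (simp add: m field_simps)
      also have "\<dots> \<le> \<delta> * real (block_end k n)"
        using growth[of m] \<open>\<delta> > 0\<close> by (simp add: m)
      also have "\<dots> \<le> real (k n)" using share n by blast
      finally show "norm (real (k n)) \<ge> \<delta> / (1 + \<delta>) * norm ((1 + \<delta>) ^ n)"
        using \<open>\<delta> > 0\<close> by simp
    qed
  qed (use \<open>\<delta> > 0\<close> in simp)
qed (use \<open>\<delta> > 0\<close> in simp)

theorem theorem3p10:
  fixes e :: "nat \<Rightarrow> 'a::complex_hilbert" and k :: "nat \<Rightarrow> nat"
  assumes "\<forall>n\<ge>1. k n > 0"
    and "orthonormal_basis e"
    and "\<forall>d :: nat \<Rightarrow> real.
      (\<forall>n\<ge>1. d n > 0) \<and> (\<forall>n\<ge>1. d (n + 1) \<le> d n) \<and> d \<longlonglongrightarrow> 0 \<longrightarrow>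
      (\<exists>D C Z. is_diag e d D \<and> compact_operator C \<and> bounded_operator Z \<and>
         (\<forall>x. D x = C (Z x) - Z (C x)) \<and>
         (block_tridiagonal k e C \<or> block_tridiagonal k e Z))"
  shows "\<exists>\<rho>>1. (\<lambda>n. real (k n)) \<in> \<Omega>(\<lambda>n. \<rho> ^ n)"
proof -
  have "\<forall>\<^sub>F n in sequentially. (\<Sum>j\<in>{1..block_end k n}. d j) < real (k n)"
    if d: "\<And>n. n \<ge> 1 \<Longrightarrow> d n > 0" "\<And>n. n \<ge> 1 \<Longrightarrow> d (n + 1) \<le> d n" "d \<longlonglongrightarrow> 0" for d :: "nat \<Rightarrow> real"
  proof -
    obtain D C Z where "is_diag e d D" "compact_operator C" "bounded_operator Z"
      "\<forall>x. D x = C (Z x) - Z (C x)" "block_tridiagonal k e C \<or> block_tridiagonal k e Z"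
      using assms(3) d by blast
    then show ?thesis by (rule partial_sums_of_commutator_diagonal[OF assms(2,1)])
  qed
  then obtain \<delta> where "\<delta> > 0" "\<forall>n\<ge>1. \<delta> * real (block_end k n) \<le> real (k n)"
    using block_proportion_bounded_below[OF assms(1)] by blast
  then show ?thesis using exponential_growth_if_proportion_bounded_below[OF assms(1)] by blast
qed

end
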